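(* Let $X\in\mathbb{R}^{n\times m}$ with $n>m$ and let $k=\operatorname{rank}(X)<m$. Then the following are equivalent: (i) Each column of $X_{[k]}$ has elements of the same sign. (ii) For every $u\in\mathbb{R}^m$, $S^-(Xu)\le k-1$.
   Context: $X_{[k]}\in\mathbb{R}^{\binom{n}{k}\times\binom{m}{k}}$ is the $k$-th multiplicative compound matrix of $X$: its entries are the $k\times k$ minors $\det X_{I,J}$, where the row index sets $I\subset\{1,\dots,n\}$ and column index sets $J\subset\{1,\dots,m\}$ of cardinality $k$ are ordered lexicographically; $I$ indexes rows and $J$ indexes columns of $X_{[k]}$. A column "has elements of the same sign" if all its entries are $\ge0$ or all its entries are $\le0$ (the sign may differ between columns). For a real vector $v\neq0$, $S^-(v)$ is the number of sign changes in $v$ after deleting all zero entries, and $S^-(0):=-1$. *)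

theory Defs
  imports
    Jordan_Normal_Form.DL_Rank
    Jordan_Normal_Form.DL_Submatrix
begin

text \<open>
  Index sets are 0-based, i.e. subsets of \<open>{0..<n}\<close>, each represented by its increasing
  enumeration. All subsequences of equal length appear in \<^const>\<open>subseqs\<close> in lexicographic
  order, so the list below enumerates the \<open>k\<close>-subsets lexicographically; this is what
  \<open>set_k_subsets\<close>, \<open>length_k_subsets\<close> and \<open>sorted_k_subsets\<close> establish.
\<close>

definition k_subsets :: "nat \<Rightarrow> nat \<Rightarrow> nat list list" where
  "k_subsets n k = filter (\<lambda>I. length I = k) (subseqs [0..<n])"

lemma subseqs_sorted_wrt:
  fixes xs :: "'a::linorder list"
  assumes "I \<in> set (subseqs xs)" "sorted_wrt (<) xs"
  shows "sorted_wrt (<) I \<and> set I \<subseteq> set xs"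
  using assms
proof (induction xs arbitrary: I)
  case Nil
  then show ?case by simp
next
  case (Cons x xs)
  then show ?case by (fastforce simp: Let_def)
qed

lemma sorted_wrt_in_subseqs:
  fixes xs :: "'a::linorder list"
  assumes "sorted_wrt (<) xs" "sorted_wrt (<) I" "set I \<subseteq> set xs"
  shows "I \<in> set (subseqs xs)"
  using assms
proof (induction xs arbitrary: I)
  case Nil
  then show ?case by simp
next
  case (Cons x xs)
  show ?case
  proof (cases "x \<in> set I")
    case True
    then obtain y J where I: "I = y # J" by (cases I) auto
    have "y = x" using Cons.prems True unfolding I by force
    moreover have "set J \<subseteq> set xs" using Cons.prems I \<open>y = x\<close> by fastforce
    ultimately show ?thesis using Cons I by (auto simp: Let_def)
  next
    case False
    then have "set I \<subseteq> set xs" using Cons.prems by auto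
    then show ?thesis using Cons by (auto simp: Let_def)
  qed
qed

lemma set_k_subsets:
  "set (k_subsets n k) = {I. sorted_wrt (<) I \<and> set I \<subseteq> {0..<n} \<and> length I = k}"
  using subseqs_sorted_wrt[of _ "[0..<n]"] sorted_wrt_in_subseqs[of "[0..<n]"]
  by (auto simp: k_subsets_def sorted_wrt_upt)

lemma length_filter_subseqs:
  "length (filter (\<lambda>I. length I = k) (subseqs xs)) = length xs choose k"
proof (induction xs arbitrary: k)
  case Nil
  then show ?case by (cases k) auto
next
  case (Cons x xs)
  then show ?case
    using Cons.IH[of 0] by (cases k) (simp_all add: Let_def filter_map o_def)
qed

lemma length_k_subsets: "length (k_subsets n k) = n choose k"
  by (simp add: k_subsets_def length_filter_subseqs)

lemma sorted_filter_subseqs: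
  fixes xs :: "'a::linorder list"
  assumes "sorted_wrt (<) xs"
  shows "sorted_wrt (\<lambda>I J. (I, J) \<in> lexord {(a, b). a < b})
           (filter (\<lambda>I. length I = k) (subseqs xs))"
  using assms
proof (induction xs arbitrary: k)
  case Nil
  then show ?case by simp
next
  case (Cons x xs)
  have lt: "(x # I, J) \<in> lexord {(a, b). a < b}"
    if IJ: "I \<in> set (subseqs xs)" "J \<in> set (subseqs xs)" "Suc (length I) = length J" for I J
  proof -
    obtain y J' where J: "J = y # J'" using IJ(3) by (cases J) auto
    have "y \<in> set xs" using subseqs_sorted_wrt[OF IJ(2)] Cons.prems J by auto
    then show ?thesis using Cons.prems J by auto
  qed
  show ?case
    using Cons.prems Cons.IH[of 0] Cons.IH[of "k - 1"] Cons.IH[of k] lt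
    by (cases k) (auto simp: Let_def filter_map o_def sorted_wrt_append sorted_wrt_map)
qed

lemma sorted_k_subsets:
  "sorted_wrt (\<lambda>I J. (I, J) \<in> lexord {(a, b). a < b}) (k_subsets n k)"
  unfolding k_subsets_def by (rule sorted_filter_subseqs) (simp add: sorted_wrt_upt)

definition compound_mat :: "nat \<Rightarrow> real mat \<Rightarrow> real mat" where
  "compound_mat k A = mat (dim_row A choose k) (dim_col A choose k)
     (\<lambda>(i, j). det (submatrix A (set (k_subsets (dim_row A) k ! i))
                                (set (k_subsets (dim_col A) k ! j))))"

definition same_sign :: "real vec \<Rightarrow> bool" where
  "same_sign v \<longleftrightarrow> (\<forall>i<dim_vec v. v $ i \<ge> 0) \<or> (\<forall>i<dim_vec v. v $ i \<le> 0)"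

definition S_minus :: "real vec \<Rightarrow> int" where
  "S_minus v =
     (if v = 0\<^sub>v (dim_vec v) then -1
      else (let xs = filter (\<lambda>x. x \<noteq> 0) (list_of_vec v)
            in int (card {i. Suc i < length xs \<and> xs ! i * xs ! Suc i < 0})))"

end

theory Submission
  imports Defs "HOL-Library.Sublist" "Jordan_Normal_Form.DL_Rank_Submatrix"
begin

text \<open>
  The theorem is about the column space of \<open>X\<close>. Let \<open>B\<close> consist of \<open>k\<close> columns of \<open>X\<close>; its maximal
  minors form one column of the compound matrix. If these columns are dependent, that column of
  the compound matrix vanishes; otherwise they are a basis of the column space. So the theorem
  reduces to the following statement of Gantmacher and Krein about an \<open>n \<times> k\<close> matrix \<open>B\<close> that has
  a nonzero maximal minor: all nonzero maximal minors have the same sign if and only if no vector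
  \<open>B x\<close> alternates strictly in sign along \<open>k + 1\<close> indices (\<open>k_le_S_minus_iff\<close> translates this into a
  bound on \<open>S_minus\<close>).

  Both directions use one identity (\<open>minor_relation\<close>): for rows \<open>T\<^sub>0 < \<dots> < T\<^sub>k\<close>, with \<open>q\<^sub>i\<close> the minor
  of \<open>B\<close> in all these rows but \<open>T\<^sub>i\<close>, the alternating sum of the products of \<open>q\<^sub>i\<close> with the entry
  of \<open>B x\<close> at \<open>T\<^sub>i\<close> is zero.

  If all minors are nonzero with a common sign, an alternating \<open>B x\<close> would make all terms of the
  identity have the same sign. Minors that vanish are first made nonzero by adding small multiples
  of rows to neighbouring rows, which respects the common sign of the minors and the strict
  alternation (\<open>no_alternation_of_same_sign_minors\<close>).

  Conversely, if two of the \<open>q\<^sub>i\<close> for one \<open>T\<close> have opposite signs, the identity can be solved by an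
  alternating vector, and this vector is of the form \<open>B x\<close> (\<open>adjacent_minors_same_sign\<close>). Any two
  nonzero minors are joined by a chain of nonzero minors in which consecutive ones differ by the
  exchange of one row (\<open>minor_exchange\<close>), hence all of them have the same sign
  (\<open>minors_same_sign_of_no_alternation\<close>).

  That some \<open>k\<close> columns contain a nonzero minor and span the column space is
  \<open>rank_minor_exists\<close>.
\<close>

section \<open>Sign changes and alternating index lists\<close>

fun sign_changes :: "real list \<Rightarrow> nat" where
  "sign_changes (x # y # xs) = (if x * y < 0 then 1 else 0) + sign_changes (y # xs)"
| "sign_changes xs = 0"

lemma card_sign_changes:
  "card {i. Suc i < length xs \<and> xs ! i * xs ! Suc i < 0} = sign_changes xs"
proof (induction xs rule: sign_changes.induct)
  case (1 x y xs)
  let ?A = "\<lambda>zs :: real list. {i. Suc i < length zs \<and> zs ! i * zs ! Suc i < 0}"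
  have fin: "finite (?A zs)" for zs
    by (rule finite_subset[of _ "{..<length zs}"]) auto
  have "?A (x # y # xs) = (if x * y < 0 then {0} else {}) \<union> Suc ` ?A (y # xs)"
  proof (rule Set.set_eqI)
    fix i show "i \<in> ?A (x # y # xs) \<longleftrightarrow> i \<in> (if x * y < 0 then {0} else {}) \<union> Suc ` ?A (y # xs)"
      by (cases i) auto
  qed
  moreover have "card (Suc ` ?A (y # xs)) = card (?A (y # xs))"
    by (simp add: card_image)
  moreover have "card ((if x * y < 0 then {0} else {}) \<union> Suc ` ?A (y # xs)) =
      (if x * y < 0 then 1 else 0) + card (Suc ` ?A (y # xs))"
    using fin[of "y # xs"] by (subst card_Un_disjoint) (auto split: if_splits)
  ultimately show ?case using 1 by (simp only: sign_changes.simps)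
qed auto

text \<open>
  Keep the head of every maximal block of entries of equal sign: each sign change of the list
  opens one new block.
\<close>

lemma alternating_subseq_exists:
  assumes "0 \<notin> set (x # xs)"
  shows "\<exists>ys. subseq ys xs \<and> length ys = sign_changes (x # xs)
           \<and> successively (\<lambda>a b. a * b < 0) (x # ys)"
  using assms
proof (induction xs arbitrary: x)
  case Nil
  then show ?case by simp
next
  case (Cons y xs)
  have "0 \<notin> set (y # xs)" using Cons.prems by simp
  from Cons.IH[OF this] obtain ys where ys: "subseq ys xs" "length ys = sign_changes (y # xs)"
      "successively (\<lambda>a b. a * b < 0) (y # ys)" by blast
  show ?case
  proof (cases "x * y < 0")
    case True
    then show ?thesis using ys by (intro exI[of _ "y # ys"]) auto
  next
    case False
    moreover have "x \<noteq> 0" "y \<noteq> 0" using Cons.prems by auto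
    ultimately have "y * z < 0 \<Longrightarrow> x * z < 0" for z
      by (auto simp: mult_less_0_iff not_less)
    then have "successively (\<lambda>a b. a * b < 0) (x # ys)"
      using ys(3) by (cases ys) auto
    then show ?thesis using ys False by (intro exI[of _ ys]) auto
  qed
qed

text \<open>
  Conversely no alternating sublist can beat the number of blocks. Fixing the head \<open>x\<close> of both
  lists makes the induction work: each further entry of \<open>xs\<close> either takes over the role of \<open>x\<close> or
  opens a new block.
\<close>

lemma alternating_subseq_le:
  assumes "subseq ys xs" "0 \<notin> set (x # xs)" "successively (\<lambda>a b. a * b < 0) (x # ys)"
  shows "length ys \<le> sign_changes (x # xs)"
  using assms
proof (induction xs arbitrary: x ys rule: list.induct)
  case Nil
  then show ?case by simp
next
  case (Cons y xs)
  show ?case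
  proof (cases "\<exists>zs. ys = y # zs \<and> subseq zs xs")
    case True
    then obtain zs where zs: "ys = y # zs" "subseq zs xs" by blast
    then have "length zs \<le> sign_changes (y # xs)"
      using Cons.IH[of zs y] Cons.prems by auto
    then show ?thesis using zs Cons.prems by auto
  next
    case False
    then have "subseq ys xs"
      using Cons.prems(1) by (auto elim: list_emb.cases)
    \<comment> \<open>Either \<open>y\<close> shares its sign with \<open>x\<close> and can replace it as head of the alternating
      list, or passing from \<open>x\<close> to \<open>y\<close> is itself a sign change, which pays for the head
      of \<open>ys\<close>.\<close>
    show ?thesis
    proof (cases "x * y < 0")
      case False
      moreover have "x \<noteq> 0" "y \<noteq> 0" using Cons.prems by auto
      ultimately have "x * z < 0 \<Longrightarrow> y * z < 0" for z
        by (auto simp: mult_less_0_iff not_less)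
      then have "successively (\<lambda>a b. a * b < 0) (y # ys)"
        using Cons.prems(3) by (cases ys) auto
      then show ?thesis using Cons.IH[OF \<open>subseq ys xs\<close>] Cons.prems False by auto
    next
      case True
      show ?thesis
      proof (cases ys)
        case (Cons z zs)
        have "z \<noteq> 0"
          using Cons.prems(3) Cons by auto
        have "length zs \<le> sign_changes (y # xs)"
        proof -
          have "subseq zs xs" using \<open>subseq ys xs\<close> Cons subseq_Cons' by metis
          moreover have "successively (\<lambda>a b. a * b < 0) (y # zs)"
          proof (cases zs)
            case (Cons w ws)
            then have "x * z < 0" "z * w < 0" "successively (\<lambda>a b. a * b < 0) zs"
              using Cons.prems(3) \<open>ys = z # zs\<close> by auto
            then have "y * w < 0" using True
              by (auto simp: mult_less_0_iff)
            then show ?thesis using Cons \<open>successively _ zs\<close> by simp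
          qed simp
          ultimately show ?thesis using Cons.IH Cons.prems by auto
        qed
        then show ?thesis using True Cons by simp
      qed simp
    qed
  qed
qed

abbreviation increasing_lists :: "nat \<Rightarrow> nat \<Rightarrow> nat list set" where
  "increasing_lists n k \<equiv> set (k_subsets n k)"

text \<open>
  Only the sign of \<open>c\<close> matters; it covers the two alternating sign patterns at once.
\<close>

definition alternates_on :: "(nat \<Rightarrow> real) \<Rightarrow> nat list \<Rightarrow> bool" where
  "alternates_on v T \<longleftrightarrow> (\<exists>c. \<forall>i<length T. c * (-1) ^ i * v (T ! i) > 0)"

lemma alternates_on_iff_successively:
  "alternates_on v T \<longleftrightarrow> successively (\<lambda>a b. a * b < 0) (map v T) \<and> 0 \<notin> set (map v T)"
proof (cases "T = []")
  case True
  then show ?thesis by (simp add: alternates_on_def)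
next
  case False
  show ?thesis
  proof
    assume "alternates_on v T"
    then obtain c where c: "\<And>i. i < length T \<Longrightarrow> c * (-1) ^ i * v (T ! i) > 0"
      unfolding alternates_on_def by blast
    have "v (T ! i) * v (T ! Suc i) < 0" if "Suc i < length T" for i
    proof -
      define d where "d = c * (-1) ^ i"
      have "0 < d * v (T ! i)" "d * v (T ! Suc i) < 0"
        using c[of i] c[of "Suc i"] that by (simp_all add: d_def)
      then show ?thesis by (auto simp: zero_less_mult_iff mult_less_0_iff)
    qed
    moreover have "v (T ! i) \<noteq> 0" if "i < length T" for i
      using c[OF that] by auto
    ultimately show "successively (\<lambda>a b. a * b < 0) (map v T) \<and> 0 \<notin> set (map v T)"
      by (auto simp: successively_conv_nth in_set_conv_nth)
  next
    assume *: "successively (\<lambda>a b. a * b < 0) (map v T) \<and> 0 \<notin> set (map v T)"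
    have "v (T ! 0) * (-1) ^ i * v (T ! i) > 0" if "i < length T" for i
      using that
    proof (induction i)
      case 0
      have "v (T ! 0) \<in> set (map v T)" using 0 by simp
      then have "v (T ! 0) \<noteq> 0" using * by metis
      then show ?case by (auto simp: zero_less_mult_iff neq_iff)
    next
      case (Suc i)
      have "v (T ! i) * v (T ! Suc i) < 0"
        using * Suc.prems by (auto simp: successively_conv_nth)
      moreover define d where "d = v (T ! 0) * (-1) ^ i"
      moreover have "0 < d * v (T ! i)" using Suc by (simp add: d_def)
      ultimately have "d * v (T ! Suc i) < 0" by (auto simp: zero_less_mult_iff mult_less_0_iff)
      then show ?case by (simp add: d_def)
    qed
    then show "alternates_on v T" unfolding alternates_on_def by blast
  qed
qed

lemma subseqs_map: "subseqs (map f xs) = map (map f) (subseqs xs)"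
  by (induction xs) (simp_all add: Let_def)

text \<open>
  This is the form in which the proof uses \<^const>\<open>S_minus\<close>: the bound \<open>S_minus v \<le> k - 1\<close>
  fails exactly if \<open>v\<close> strictly alternates along some \<open>k + 1\<close> indices. The zero vector fits in
  because its value \<open>-1\<close> is below every \<open>k\<close>.
\<close>

lemma k_le_S_minus_iff:
  fixes v :: "real vec"
  shows "int k \<le> S_minus v \<longleftrightarrow> (\<exists>T \<in> increasing_lists (dim_vec v) (Suc k). alternates_on (($) v) T)"
proof -
  define xs where "xs = filter (\<lambda>x. x \<noteq> 0) (list_of_vec v)"
  have map_v: "list_of_vec v = map (($) v) [0..<dim_vec v]"
    by (intro nth_equalityI) (auto simp: list_of_vec_index)
  have xs0: "0 \<notin> set xs" by (simp add: xs_def)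
  have Smin: "S_minus v = (if xs = [] then -1 else int (sign_changes xs))"
  proof -
    have "v = 0\<^sub>v (dim_vec v) \<longleftrightarrow> xs = []"
      by (auto simp: xs_def map_v filter_empty_conv intro!: eq_vecI) (metis index_zero_vec(1))
    then show ?thesis
      unfolding S_minus_def card_sign_changes xs_def Let_def by simp
  qed
  have "(\<exists>T \<in> increasing_lists (dim_vec v) (Suc k). alternates_on (($) v) T) \<longleftrightarrow>
      (\<exists>zs \<in> set (subseqs (list_of_vec v)). length zs = Suc k \<and>
          successively (\<lambda>a b. a * b < 0) zs \<and> 0 \<notin> set zs)"
    unfolding map_v subseqs_map k_subsets_def alternates_on_iff_successively by auto
  also have "\<dots> \<longleftrightarrow> (\<exists>zs. subseq zs xs \<and> length zs = Suc k \<and>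
          successively (\<lambda>a b. a * b < 0) zs)" (is "?L \<longleftrightarrow> ?R")
  proof
    assume ?L
    then obtain zs where zs: "subseq zs (list_of_vec v)" "length zs = Suc k"
        "successively (\<lambda>a b. a * b < 0) zs" "0 \<notin> set zs" by auto
    have "filter (\<lambda>x. x \<noteq> 0) zs = zs" using zs(4) by (auto simp: filter_id_conv)
    moreover have "subseq (filter (\<lambda>x. x \<noteq> 0) zs) xs"
      unfolding xs_def by (rule subseq_filter[OF zs(1)])
    ultimately show ?R using zs by metis
  next
    assume ?R
    then obtain zs where zs: "subseq zs xs" "length zs = Suc k"
        "successively (\<lambda>a b. a * b < 0) zs" by auto
    have "subseq zs (list_of_vec v)"
      using zs(1) subseq_filter_left unfolding xs_def by (rule subseq_order.trans)
    moreover have "0 \<notin> set zs"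
      using zs(1) xs0 by (auto simp: subseq_conv_nths dest: in_set_nthsD)
    ultimately show ?L using zs by auto
  qed
  also have "\<dots> \<longleftrightarrow> xs \<noteq> [] \<and> k \<le> sign_changes xs"
  proof (cases xs)
    case Nil
    then show ?thesis by auto
  next
    case (Cons x xs')
    show ?thesis
    proof
      assume "\<exists>zs. subseq zs xs \<and> length zs = Suc k \<and> successively (\<lambda>a b. a * b < 0) zs"
      then obtain z zs where zs: "subseq (z # zs) xs" "length zs = k"
          "successively (\<lambda>a b. a * b < 0) (z # zs)"
        by (auto simp: length_Suc_conv)
      \<comment> \<open>The head \<open>z\<close> of the alternating list need not be the head \<open>x\<close> of \<open>xs\<close>. If their
        signs agree, \<open>x\<close> can replace \<open>z\<close>; otherwise \<open>x\<close> can be put in front.\<close>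
      have sub: "subseq zs xs'" using zs(1) Cons subseq_Cons' by (cases "z = x") (auto dest: subseq_Cons')
      have "x \<noteq> 0" using xs0 Cons by auto
      have "k \<le> sign_changes (x # xs')"
      proof (cases "x * z < 0")
        case True
        then have "subseq (z # zs) xs'" using zs(1) Cons
          by (cases "z = x") (auto simp: mult_less_0_iff)
        then have "length (z # zs) \<le> sign_changes (x # xs')"
          using xs0 Cons zs(3) True by (intro alternating_subseq_le) auto
        then show ?thesis using zs(2) by simp
      next
        case False
        have "x * w < 0" if "z * w < 0" for w
          using that False \<open>x \<noteq> 0\<close> by (auto simp: mult_less_0_iff not_less)
        then have "successively (\<lambda>a b. a * b < 0) (x # zs)"
          using zs(3) by (cases zs) auto
        then have "length zs \<le> sign_changes (x # xs')"
          using xs0 Cons sub by (intro alternating_subseq_le) auto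
        then show ?thesis using zs(2) by simp
      qed
      then show "xs \<noteq> [] \<and> k \<le> sign_changes xs" using Cons by simp
    next
      assume "xs \<noteq> [] \<and> k \<le> sign_changes xs"
      then obtain ys where ys: "subseq ys xs'" "length ys = sign_changes xs"
           "successively (\<lambda>a b. a * b < 0) (x # ys)"
        using alternating_subseq_exists[of x xs'] xs0 Cons by auto
      have "subseq (x # take k ys) xs"
        using ys(1) Cons by (auto intro!: subseq_Cons2 intro: subseq_order.trans[OF prefix_imp_subseq[OF take_is_prefix]])
      moreover have "successively (\<lambda>a b. a * b < 0) (x # take k ys)"
        using ys(3) by (metis append_take_drop_id successively_append_iff append_Cons)
      ultimately show "\<exists>zs. subseq zs xs \<and> length zs = Suc k \<and> successively (\<lambda>a b. a * b < 0) zs"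
        using ys(2) \<open>xs \<noteq> [] \<and> k \<le> sign_changes xs\<close>
        by (intro exI[of _ "x # take k ys"]) auto
    qed
  qed
  also have "\<dots> \<longleftrightarrow> int k \<le> S_minus v" unfolding Smin by auto
  finally show ?thesis by simp
qed

section \<open>Maximal minors and the vectors they act on\<close>

text \<open>
  A matrix with \<open>k\<close> columns is a function \<open>B\<close> of a row and a column index, and \<open>minor B I\<close> is its
  maximal minor in the rows \<open>I\<close>; the number of columns is read off from \<open>I\<close>. Allowing lists that
  are not increasing lets a row be replaced inside a minor without reordering.
\<close>

definition minor :: "(nat \<Rightarrow> nat \<Rightarrow> real) \<Rightarrow> nat list \<Rightarrow> real" where
  "minor B I = det (mat (length I) (length I) (\<lambda>(i, j). B (I ! i) j))"

text \<open>
  The vector \<open>B x\<close>, as a function of the row index.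
\<close>

definition combine :: "(nat \<Rightarrow> nat \<Rightarrow> real) \<Rightarrow> nat \<Rightarrow> (nat \<Rightarrow> real) \<Rightarrow> nat \<Rightarrow> real" where
  "combine B k x i = (\<Sum>j<k. B i j * x j)"

definition drop_nth :: "nat \<Rightarrow> 'a list \<Rightarrow> 'a list" where
  "drop_nth i xs = take i xs @ drop (Suc i) xs"

lemma length_drop_nth: "i < length xs \<Longrightarrow> length (drop_nth i xs) = length xs - 1"
  by (simp add: drop_nth_def)

lemma nth_drop_nth:
  "i < length xs \<Longrightarrow> l < length xs - 1 \<Longrightarrow>
    drop_nth i xs ! l = xs ! (if l < i then l else Suc l)"
  by (auto simp: drop_nth_def nth_append min_def)

lemma minor_eq_0_iff:
  "minor B I = 0 \<longleftrightarrow>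
    (\<exists>x. (\<exists>j<length I. x j \<noteq> 0) \<and> (\<forall>i\<in>set I. combine B (length I) x i = 0))"
proof -
  let ?k = "length I"
  let ?A = "mat ?k ?k (\<lambda>(i, j). B (I ! i) j)"
  have mv: "(?A *\<^sub>v v) $ i = combine B ?k (($) v) (I ! i)" if "v \<in> carrier_vec ?k" "i < ?k" for v i
    using that by (auto simp: combine_def scalar_prod_def lessThan_atLeast0 intro!: sum.cong)
  have "minor B I = 0 \<longleftrightarrow>
      (\<exists>v. v \<in> carrier_vec ?k \<and> v \<noteq> 0\<^sub>v ?k \<and> ?A *\<^sub>v v = 0\<^sub>v ?k)"
    unfolding minor_def by (rule det_0_iff_vec_prod_zero) simp
  also have "\<dots> \<longleftrightarrow> (\<exists>x. (\<exists>j<?k. x j \<noteq> 0) \<and> (\<forall>i\<in>set I. combine B ?k x i = 0))"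
    (is "?L \<longleftrightarrow> ?R")
  proof
    assume ?L
    then obtain v where v: "v \<in> carrier_vec ?k" "v \<noteq> 0\<^sub>v ?k" "?A *\<^sub>v v = 0\<^sub>v ?k" by blast
    have "\<exists>j<?k. v $ j \<noteq> 0"
      using v(1,2) by (metis carrier_vecD eq_vecI index_zero_vec)
    moreover have "combine B ?k (($) v) (I ! i) = 0" if "i < ?k" for i
      using mv[OF v(1) that] v(3) that by simp
    ultimately show ?R by (metis in_set_conv_nth)
  next
    assume ?R
    then obtain x where x: "\<exists>j<?k. x j \<noteq> 0" "\<forall>i\<in>set I. combine B ?k x i = 0" by blast
    have "vec ?k x \<noteq> 0\<^sub>v ?k" using x(1) by (metis index_vec index_zero_vec(1))
    moreover have "?A *\<^sub>v vec ?k x = 0\<^sub>v ?k"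
    proof (rule eq_vecI)
      fix i assume "i < dim_vec (0\<^sub>v ?k :: real vec)"
      then have i: "i < ?k" by simp
      have "combine B ?k (($) (vec ?k x)) (I ! i) = combine B ?k x (I ! i)"
        by (simp add: combine_def)
      then show "(?A *\<^sub>v vec ?k x) $ i = 0\<^sub>v ?k $ i"
        using mv[of "vec ?k x" i] i x(2) by simp
    qed simp
    ultimately show ?L by (metis vec_carrier)
  qed
  finally show ?thesis .
qed

lemma combine_surj_on_rows:
  assumes "minor B I \<noteq> 0"
  shows "\<exists>x. \<forall>l<length I. combine B (length I) x (I ! l) = y l"
proof -
  let ?k = "length I"
  let ?A = "mat ?k ?k (\<lambda>(i, j). B (I ! i) j)"
  obtain Q where Q: "Q \<in> carrier_mat ?k ?k" "?A * Q = 1\<^sub>m ?k"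
    using det_non_zero_imp_unit[of ?A ?k "()"] assms
    unfolding minor_def Units_def ring_mat_def by auto
  define w where "w = Q *\<^sub>v vec ?k (\<lambda>i. y i)"
  have w: "w \<in> carrier_vec ?k" using Q by (simp add: w_def)
  have "?A *\<^sub>v w = (?A * Q) *\<^sub>v vec ?k (\<lambda>i. y i)"
    unfolding w_def using Q(1) by (simp add: assoc_mult_mat_vec[of _ ?k ?k _ ?k])
  also have "\<dots> = vec ?k (\<lambda>i. y i)" using Q(2) by simp
  finally have Aw: "?A *\<^sub>v w = vec ?k (\<lambda>i. y i)" .
  have "combine B ?k (($) w) (I ! i) = y i" if "i < ?k" for i
  proof -
    have "combine B ?k (($) w) (I ! i) = (?A *\<^sub>v w) $ i"
      using that w by (auto simp: combine_def scalar_prod_def lessThan_atLeast0 intro!: sum.cong)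
    then show ?thesis using Aw that by simp
  qed
  then show ?thesis by blast
qed

text \<open>
  The \<open>(k + 1) \<times> (k + 1)\<close> matrix formed by \<open>B x\<close> and \<open>B\<close> in the rows \<open>T\<close> is singular,
  because its first column is a combination of the others. The relation is the Laplace expansion
  of its determinant along that column. It ties the sign pattern of \<open>B x\<close> to the signs of the
  minors, and both directions of the theorem rest on it.
\<close>

lemma minor_relation:
  assumes T: "length T = Suc k"
  shows "(\<Sum>i<Suc k. (-1) ^ i * combine B k x (T ! i) * minor B (drop_nth i T)) = 0"
proof -
  define M where "M = mat (Suc k) (Suc k)
    (\<lambda>(i, j). if j = 0 then combine B k x (T ! i) else B (T ! i) (j - 1))"
  have M: "M \<in> carrier_mat (Suc k) (Suc k)" by (simp add: M_def)
  have "M *\<^sub>v vec (Suc k) (\<lambda>j. if j = 0 then -1 else x (j - 1)) = 0\<^sub>v (Suc k)"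
    by (intro eq_vecI)
      (auto simp: M_def scalar_prod_def combine_def sum.atLeast0_lessThan_Suc_shift lessThan_atLeast0
          simp del: sum.op_ivl_Suc)
  moreover have "vec (Suc k) (\<lambda>j. if j = 0 then -1 else x (j - 1)) \<noteq> 0\<^sub>v (Suc k)"
    by (auto dest!: arg_cong[of _ _ "\<lambda>v. v $ 0"])
  ultimately have "det M = 0"
    using det_0_iff_vec_prod_zero[OF M] by (metis vec_carrier)
  moreover have "det M = (\<Sum>i<Suc k. M $$ (i, 0) * cofactor M i 0)"
    by (rule laplace_expansion_column[OF M]) simp
  moreover have "M $$ (i, 0) * cofactor M i 0 =
      (-1) ^ i * combine B k x (T ! i) * minor B (drop_nth i T)" if "i < Suc k" for i
  proof -
    have "mat_delete M i 0 =
        mat (length (drop_nth i T)) (length (drop_nth i T)) (\<lambda>(l, j). B (drop_nth i T ! l) j)"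
      using that T by (intro eq_matI) (auto simp: mat_delete_def M_def length_drop_nth nth_drop_nth)
    then show ?thesis using that by (simp add: cofactor_def minor_def M_def)
  qed
  ultimately show ?thesis by simp
qed

text \<open>
  Linearity of the determinant in one row. For a list without repetition at most one summand is
  present; the sum avoids naming the position of \<open>a\<close>.
\<close>

lemma minor_add_row:
  assumes "distinct I" "length I = k"
  shows "minor (B(a := \<lambda>j. B a j + e * B c j)) I =
    minor B I + (\<Sum>i<k. if I ! i = a then e * minor B (I[i := c]) else 0)"
proof (cases "a \<in> set I")
  case False
  then have "minor (B(a := \<lambda>j. B a j + e * B c j)) I = minor B I"
    unfolding minor_def by (auto intro!: arg_cong[of _ _ det] eq_matI)
  moreover have "(\<Sum>i<k. if I ! i = a then e * minor B (I[i := c]) else 0) = 0"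
    using False assms by (intro sum.neutral) auto
  ultimately show ?thesis by simp
next
  case True
  then obtain p where p: "p < k" "I ! p = a" using assms by (auto simp: in_set_conv_nth)
  have uniq: "I ! i = a \<longleftrightarrow> i = p" if "i < k" for i
    using p that assms by (metis nth_eq_iff_index_eq)
  define M where "M = (\<lambda>r. mat k k (\<lambda>(i, j). if i = p then r j else B (I ! i) j))"
  have "det (M r) = (\<Sum>j<k. r j * cofactor (M (\<lambda>_. 0)) p j)" for r
  proof -
    have "det (M r) = (\<Sum>j<k. M r $$ (p, j) * cofactor (M r) p j)"
      using p by (intro laplace_expansion_row) (auto simp: M_def)
    moreover have "mat_delete (M r) p j = mat_delete (M (\<lambda>_. 0)) p j" for j
      using p by (intro eq_matI) (auto simp: mat_delete_def M_def)
    ultimately show ?thesis using p by (simp add: cofactor_def M_def)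
  qed
  then have "det (M (\<lambda>j. B a j + e * B c j)) = det (M (B a)) + e * det (M (B c))"
    by (simp add: sum.distrib sum_distrib_left algebra_simps)
  moreover have "minor (B(a := \<lambda>j. B a j + e * B c j)) I = det (M (\<lambda>j. B a j + e * B c j))"
    unfolding minor_def M_def using p(1) assms
    by (auto simp: uniq p(2) intro!: arg_cong[of _ _ det] eq_matI)
  moreover have "minor B I = det (M (B a))"
    unfolding minor_def M_def using p(1) assms
    by (auto simp: uniq p(2) intro!: arg_cong[of _ _ det] eq_matI)
  moreover have "minor B (I[p := c]) = det (M (B c))"
    unfolding minor_def M_def using p(1) assms
    by (auto simp: uniq p(2) intro!: arg_cong[of _ _ det] eq_matI)
  moreover have "(\<Sum>i<k. if I ! i = a then e * minor B (I[i := c]) else 0) = e * minor B (I[p := c])"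
  proof -
    have "(\<Sum>i<k. if I ! i = a then e * minor B (I[i := c]) else 0) =
        (\<Sum>i<k. if i = p then e * minor B (I[i := c]) else 0)"
      using uniq by (intro sum.cong) auto
    then show ?thesis using p by simp
  qed
  ultimately show ?thesis by simp
qed

lemma minor_not_distinct:
  assumes "\<not> distinct I"
  shows "minor B I = 0"
proof -
  obtain i j where ij: "i < length I" "j < length I" "i \<noteq> j" "I ! i = I ! j"
    using assms by (auto simp: distinct_conv_nth)
  then show ?thesis
    unfolding minor_def
    by (intro det_identical_rows[of _ "length I" i j]) (auto intro!: eq_vecI)
qed

section \<open>Minors of one sign exclude alternation\<close>

lemma increasing_lists_iff:
  "I \<in> increasing_lists n k \<longleftrightarrow> sorted_wrt (<) I \<and> set I \<subseteq> {0..<n} \<and> length I = k"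
  by (simp add: set_k_subsets)

lemma increasing_lists_distinct: "I \<in> increasing_lists n k \<Longrightarrow> distinct I"
  by (auto simp: increasing_lists_iff strict_sorted_iff)

lemma increasing_lists_nth_less: "I \<in> increasing_lists n k \<Longrightarrow> i < length I \<Longrightarrow> I ! i < n"
  by (metis increasing_lists_iff nth_mem subsetD atLeastLessThan_iff)

lemma slide_mem_increasing_lists:
  assumes "J \<in> increasing_lists n k" "l < k" "c < n" "c = Suc (J ! l) \<or> J ! l = Suc c"
    and "distinct (J[l := c])"
  shows "J[l := c] \<in> increasing_lists n k"
proof -
  have J: "sorted_wrt (<) J" "set J \<subseteq> {0..<n}" "length J = k"
    using assms(1) by (auto simp: increasing_lists_iff)
  have "J[l := c] ! p < J[l := c] ! q" if "p < q" "q < k" for p q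
  proof -
    have "J ! p < J ! q" using J(1,3) that by (auto simp: sorted_wrt_iff_nth_less)
    moreover have "J[l := c] ! p \<noteq> J[l := c] ! q"
      using assms(5) that J(3) by (auto simp: distinct_conv_nth)
    ultimately show ?thesis using assms(2,4) that J(3) by (auto simp: nth_list_update)
  qed
  then have "sorted_wrt (<) (J[l := c])" using J(3) by (auto simp: sorted_wrt_iff_nth_less)
  moreover have "set (J[l := c]) \<subseteq> {0..<n}"
    using J(2) assms(3) set_update_subset_insert[of J l c] by auto
  ultimately show ?thesis using J(3) by (simp add: increasing_lists_iff)
qed

text \<open>
  Any index list can be pushed down to \<open>[0..<k]\<close> by lowering, as long as possible, the first entry
  that is not yet at its lowest place, one unit at a time. Hence a property preserved by moves of
  one entry to a neighbouring free index holds for all lists or for none.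
\<close>

lemma slide_connected:
  assumes step: "\<And>I i c. \<lbrakk>I \<in> increasing_lists n k; i < k; I[i := c] \<in> increasing_lists n k;
      c = Suc (I ! i) \<or> I ! i = Suc c; P I\<rbrakk> \<Longrightarrow> P (I[i := c])"
    and "I \<in> increasing_lists n k" "J \<in> increasing_lists n k" "P I"
  shows "P J"
proof -
  have "P I \<longleftrightarrow> P [0..<k]" if "I \<in> increasing_lists n k" for I
    using that
  proof (induction "sum_list I" arbitrary: I rule: less_induct)
    case less
    have I: "sorted_wrt (<) I" "set I \<subseteq> {0..<n}" "length I = k"
      using less.prems by (auto simp: increasing_lists_iff)
    show ?case
    proof (cases "I = [0..<k]")
      case False
      then have "\<exists>i<k. I ! i \<noteq> i" using I(3) by (auto simp: list_eq_iff_nth_eq)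
      then obtain i where i: "i < k" "I ! i \<noteq> i" "\<And>p. p < i \<Longrightarrow> I ! p = p"
        using exists_least_iff[of "\<lambda>i. i < k \<and> I ! i \<noteq> i"] by (auto dest: less_trans)
      have "i \<le> I ! i" using sorted_wrt_less_idx[OF I(1)] i(1) I(3) by simp
      then obtain c where c: "I ! i = Suc c" "i \<le> c" using i(2) by (cases "I ! i") auto
      have "distinct (I[i := c])"
      proof -
        have "c \<notin> set I"
        proof
          assume "c \<in> set I"
          then obtain p where p: "p < k" "I ! p = c" using I(3) by (auto simp: in_set_conv_nth)
          have "p < i"
          proof (rule ccontr)
            assume "\<not> p < i"
            then have "I ! i \<le> I ! p"
              using I(1,3) p(1) by (cases "p = i") (auto simp: sorted_wrt_iff_nth_less intro: less_imp_le)
            then show False using c p by simp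
          qed
          then show False using i(3) p c by fastforce
        qed
        then show ?thesis using increasing_lists_distinct[OF less.prems] by (auto simp: distinct_list_update)
      qed
      moreover have "I ! i < n" using I(2,3) i(1) nth_mem by fastforce
      ultimately have mem: "I[i := c] \<in> increasing_lists n k"
        using slide_mem_increasing_lists[OF less.prems i(1), of c] c by simp
      have "sum_list (I[i := c]) < sum_list I"
        using c i(1) I(3) elem_le_sum_list[of i I] by (simp add: sum_list_update)
      then have "P (I[i := c]) \<longleftrightarrow> P [0..<k]" by (rule less.hyps[OF _ mem])
      moreover have "P I \<longleftrightarrow> P (I[i := c])"
      proof
        assume "P I"
        then show "P (I[i := c])" using step[OF less.prems i(1) mem] c by simp
      next
        assume "P (I[i := c])"
        moreover have "I[i := c, i := I ! i] = I" by simp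
        ultimately show "P I"
          using step[OF mem i(1), of "I ! i"] less.prems c i(1) I(3) by simp
      qed
      ultimately show ?thesis by simp
    qed simp
  qed
  then show ?thesis using assms by blast
qed

lemma drop_nth_mem_increasing_lists:
  assumes "T \<in> increasing_lists n (Suc k)" "i < Suc k"
  shows "drop_nth i T \<in> increasing_lists n k" "set (drop_nth i T) = set T - {T ! i}"
proof -
  have T: "T = take i T @ T ! i # drop (Suc i) T"
    using assms by (intro id_take_nth_drop) (simp add: increasing_lists_iff)
  have "sorted_wrt (<) (take i T @ T ! i # drop (Suc i) T)"
       "set (take i T @ T ! i # drop (Suc i) T) \<subseteq> {0..<n}"
       "distinct (take i T @ T ! i # drop (Suc i) T)"
    unfolding T[symmetric] using assms(1) increasing_lists_distinct by (auto simp: increasing_lists_iff)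
  note * = this
  show "drop_nth i T \<in> increasing_lists n k"
    using *(1,2) assms
    by (auto simp: increasing_lists_iff drop_nth_def sorted_wrt_append)
  have "set T = set (take i T @ T ! i # drop (Suc i) T)" using T by simp
  then show "set (drop_nth i T) = set T - {T ! i}"
    using *(3) by (auto simp: drop_nth_def)
qed

text \<open>
  If all minors are nonzero and have the same sign, then a vector \<open>B x\<close> alternating along \<open>T\<close> makes
  all terms of \<open>minor_relation\<close> have the same sign, which is absurd. Minors that vanish are removed
  by a perturbation that keeps all hypotheses: adding a small positive multiple of a row to a
  \<^emph>\<open>neighbouring\<close> row changes a minor only by a multiple of another minor of the same
  sign (no reordering of rows is needed, since the two rows are neighbours), and if the multiple is
  small, it does not disturb the alternation. By connectedness under slides, as long as some minor
  vanishes there is such a step that turns a vanishing minor into a nonzero one, so the number of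
  vanishing minors serves as induction measure. The factor \<open>s\<close> is the common sign of the minors.
\<close>

lemma no_alternation_of_same_sign_minors:
  assumes "T \<in> increasing_lists n (Suc k)"
    and "\<And>I. I \<in> increasing_lists n k \<Longrightarrow> 0 \<le> s * minor B I"
    and "\<exists>I \<in> increasing_lists n k. minor B I \<noteq> 0" and "s \<noteq> 0"
  shows "\<not> alternates_on (combine B k x) T"
  using assms(2,3)
proof (induction "card {I \<in> increasing_lists n k. minor B I = 0}" arbitrary: B rule: less_induct)
  case less
  have T: "length T = Suc k" "set T \<subseteq> {0..<n}" using assms(1) by (auto simp: increasing_lists_iff)
  show ?case
  proof
    assume "alternates_on (combine B k x) T"
    then obtain d where d: "\<And>i. i < Suc k \<Longrightarrow> d * (-1) ^ i * combine B k x (T ! i) > 0"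
      unfolding alternates_on_def T by blast
    show False
    proof (cases "\<forall>I \<in> increasing_lists n k. minor B I \<noteq> 0")
      case True
      have "0 < (\<Sum>i<Suc k. (d * (-1) ^ i * combine B k x (T ! i)) * (s * minor B (drop_nth i T)))"
      proof (rule sum_pos)
        fix i assume "i \<in> {..<Suc k}"
        then have i: "i < Suc k" by simp
        have "0 < s * minor B (drop_nth i T)"
          using less.prems(1) True drop_nth_mem_increasing_lists(1)[OF assms(1) i] assms(4)
          by (simp add: order_less_le)
        then show "0 < (d * (-1) ^ i * combine B k x (T ! i)) * (s * minor B (drop_nth i T))"
          using d[OF i] by (rule mult_pos_pos[rotated])
      qed auto
      also have "\<dots> = d * s * (\<Sum>i<Suc k. (-1) ^ i * combine B k x (T ! i) * minor B (drop_nth i T))"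
        unfolding sum_distrib_left by (intro sum.cong) auto
      finally show False using minor_relation[OF T(1), of B x] by simp
    next
      case False
      have "\<exists>I i a. I \<in> increasing_lists n k \<and> i < k \<and> I[i := a] \<in> increasing_lists n k \<and>
          (a = Suc (I ! i) \<or> I ! i = Suc a) \<and> minor B I \<noteq> 0 \<and> minor B (I[i := a]) = 0"
      proof (rule ccontr)
        assume no_step: "\<not> ?thesis"
        obtain I J where "I \<in> increasing_lists n k" "J \<in> increasing_lists n k"
            "minor B I \<noteq> 0" "minor B J = 0"
          using less.prems(2) False by blast
        moreover have "minor B J \<noteq> 0"
          using calculation(1-3) no_step
          by (intro slide_connected[of n k "\<lambda>I. minor B I \<noteq> 0" I J]) blast+
        ultimately show False by blast
      qed
      then obtain I i a where I: "I \<in> increasing_lists n k" "i < k" "I[i := a] \<in> increasing_lists n k"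
          "a = Suc (I ! i) \<or> I ! i = Suc a" "minor B I \<noteq> 0" "minor B (I[i := a]) = 0"
        by blast
      \<comment> \<open>The vanishing minor contains row \<open>a\<close> in the place where the nonzero one contains row
        \<open>c\<close>. Adding a multiple of row \<open>c\<close> to row \<open>a\<close> brings the nonzero one in; the multiple
        \<open>e\<close> is too small to change the sign of the entry of \<open>B x\<close> at \<open>a\<close>.\<close>
      define c where "c = I ! i"
      define v where "v = combine B k x"
      have lenI: "length I = k" using I(1) by (simp add: increasing_lists_iff)
      have "c < n" using I(1,2) lenI nth_mem by (fastforce simp: c_def increasing_lists_iff)
      obtain e where e: "e > 0" "v a \<noteq> 0 \<longrightarrow> e * \<bar>v c\<bar> < \<bar>v a\<bar>"
      proof (cases "v a = 0")
        case False
        have "\<bar>v a\<bar> / (1 + \<bar>v c\<bar>) * \<bar>v c\<bar> < \<bar>v a\<bar>"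
          using False by (simp add: field_simps)
        moreover have "\<bar>v a\<bar> / (1 + \<bar>v c\<bar>) > 0"
          using False by (intro divide_pos_pos) auto
        ultimately show ?thesis using that by blast
      qed (use that[of 1] in auto)
      define B' where "B' = B(a := \<lambda>j. B a j + e * B c j)"
      have minor': "minor B' J = minor B J + (\<Sum>l<k. if J ! l = a then e * minor B (J[l := c]) else 0)"
        if "J \<in> increasing_lists n k" for J
        unfolding B'_def using that by (intro minor_add_row) (auto simp: increasing_lists_iff increasing_lists_distinct)
      have summand: "0 \<le> s * (if J ! l = a then e * minor B (J[l := c]) else 0)"
        if J: "J \<in> increasing_lists n k" "l < k" for J l
      proof (cases "J ! l = a \<and> distinct (J[l := c])")
        case True
        then have "J[l := c] \<in> increasing_lists n k"
          using slide_mem_increasing_lists[OF J \<open>c < n\<close>] I(4) by (auto simp: c_def)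
        then have "0 \<le> e * (s * minor B (J[l := c]))"
          using less.prems(1)[of "J[l := c]"] e(1) by simp
        then show ?thesis using True by (simp add: mult.left_commute)
      qed (auto simp: minor_not_distinct)
      have grow: "s * minor B J \<le> s * minor B' J" if "J \<in> increasing_lists n k" for J
        using sum_nonneg[of "{..<k}" "\<lambda>l. s * (if J ! l = a then e * minor B (J[l := c]) else 0)"]
          summand[OF that] unfolding minor'[OF that] by (simp add: distrib_left sum_distrib_left)
      have zeros: "minor B J = 0" if "J \<in> increasing_lists n k" "minor B' J = 0" for J
        using grow[OF that(1)] that less.prems(1)[OF that(1)] assms(4) by auto
      have "minor B' (I[i := a]) \<noteq> 0"
      proof -
        have dist: "distinct (I[i := a])" using I(3) by (rule increasing_lists_distinct)
        have "I[i := a] ! l = a \<longleftrightarrow> l = i" if "l < k" for l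
          using that dist lenI I(2) nth_eq_iff_index_eq[OF dist, of l i] by auto
        then have "(\<Sum>l<k. if I[i := a] ! l = a then e * minor B (I[i := a, l := c]) else 0) =
            (\<Sum>l<k. if l = i then e * minor B (I[i := a, l := c]) else 0)"
          by (intro sum.cong) auto
        also have "\<dots> = e * minor B I" using I(2) by (simp add: c_def)
        finally show ?thesis unfolding minor'[OF I(3)] using I(5,6) e(1) by simp
      qed
      have "{J \<in> increasing_lists n k. minor B' J = 0} \<subset> {J \<in> increasing_lists n k. minor B J = 0}"
        using zeros I(3,6) \<open>minor B' (I[i := a]) \<noteq> 0\<close> by blast
      then have "card {J \<in> increasing_lists n k. minor B' J = 0} < card {J \<in> increasing_lists n k. minor B J = 0}"
        by (intro psubset_card_mono) auto
      moreover have "0 \<le> s * minor B' J" if "J \<in> increasing_lists n k" for J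
        using grow[OF that] less.prems(1)[OF that] by simp
      moreover have "\<exists>J \<in> increasing_lists n k. minor B' J \<noteq> 0"
        using I(3) \<open>minor B' (I[i := a]) \<noteq> 0\<close> by blast
      ultimately have "\<not> alternates_on (combine B' k x) T" by (rule less.hyps)
      moreover have "alternates_on (combine B' k x) T"
        unfolding alternates_on_def
      proof (intro exI allI impI)
        fix l assume "l < length T"
        then have dl: "0 < d * (-1) ^ l * v (T ! l)" using d T(1) by (simp add: v_def)
        show "0 < d * (-1) ^ l * combine B' k x (T ! l)"
        proof (cases "T ! l = a")
          case True
          define f where "f = d * (-1) ^ l"
          have "0 < f * v a" using dl True by (simp add: f_def)
          then have "\<bar>f\<bar> * (e * \<bar>v c\<bar>) < \<bar>f\<bar> * \<bar>v a\<bar>"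
            using e(2) by (intro mult_strict_left_mono) auto
          also have "\<dots> = f * v a" using \<open>0 < f * v a\<close> by (simp flip: abs_mult)
          finally have "\<bar>f * (e * v c)\<bar> < f * v a" using e(1) by (simp add: abs_mult)
          then have "0 < f * (v a + e * v c)" by (simp add: distrib_left abs_less_iff)
          moreover have "combine B' k x a = v a + e * v c"
            by (simp add: combine_def B'_def v_def algebra_simps sum.distrib sum_distrib_left)
          ultimately show ?thesis using True by (simp add: f_def)
        next
          case False
          then show ?thesis using dl by (simp add: combine_def B'_def v_def)
        qed
      qed
      ultimately show False by blast
    qed
  qed
qed

section \<open>Excluding alternation forces minors of one sign\<close>

text \<open>
  Suppose two of the minors \<open>q\<^sub>i\<close> obtained by deleting one entry of \<open>T\<close> have opposite signs. Then
  some positive weights satisfy \<open>\<Sum>\<^sub>i t\<^sub>i q\<^sub>i = 0\<close>. As the minor \<open>q\<^sub>a\<close> is nonzero, the values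
  \<open>(-1)\<^sup>i t\<^sub>i\<close> can be prescribed for \<open>B x\<close> on all rows of \<open>T\<close> but the \<open>a\<close>-th, and
  \<open>minor_relation\<close> then forces the value \<open>(-1)\<^sup>a t\<^sub>a\<close> there, so that \<open>B x\<close> alternates along \<open>T\<close>.
\<close>

lemma adjacent_minors_same_sign:
  assumes noalt: "\<And>x. \<not> alternates_on (combine B k x) T"
    and T: "length T = Suc k" and ab: "a < Suc k" "b < Suc k"
  shows "0 \<le> minor B (drop_nth a T) * minor B (drop_nth b T)"
proof (rule ccontr)
  define q where "q = (\<lambda>i. minor B (drop_nth i T))"
  assume "\<not> ?thesis"
  then have neg: "q a * q b < 0" by (simp add: q_def)
  then have "a \<noteq> b" by (auto simp: mult_less_0_iff)
  have "q a \<noteq> 0" using neg by auto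
  define r where "r = - q b / q a"
  have "r > 0" using neg by (auto simp: r_def mult_less_0_iff divide_pos_neg divide_neg_pos)
  \<comment> \<open>All weights other than \<open>t\<^sub>a\<close> and \<open>t\<^sub>b\<close> are 1, and \<open>t\<^sub>b = L\<close> is so large that the value
    of \<open>t\<^sub>a\<close> which makes the weighted sum vanish is positive.\<close>
  define S where "S = (\<Sum>i \<in> {..<Suc k} - {a} - {b}. q i)"
  define L where "L = (\<bar>S / q a\<bar> + 1) / r"
  have "\<bar>S / q a\<bar> + 1 > 0" using abs_ge_zero[of "S / q a"] by linarith
  then have "L > 0" using \<open>r > 0\<close> unfolding L_def by (rule divide_pos_pos)
  define t where "t = (\<lambda>i. if i = a then L * r - S / q a else if i = b then L else 1)"
  have t_pos: "t i > 0" for i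
  proof -
    have "L * r = \<bar>S / q a\<bar> + 1" using \<open>r > 0\<close> by (simp add: L_def)
    then have "L * r - S / q a > 0" using abs_ge_self[of "S / q a"] by linarith
    then show ?thesis using \<open>L > 0\<close> by (simp add: t_def)
  qed
  have t_sum: "(\<Sum>i<Suc k. t i * q i) = 0"
  proof -
    have "(\<Sum>i<Suc k. t i * q i) = t a * q a + (\<Sum>i \<in> {..<Suc k} - {a}. t i * q i)"
      using ab(1) by (intro sum.remove) auto
    also have "(\<Sum>i \<in> {..<Suc k} - {a}. t i * q i) =
        t b * q b + (\<Sum>i \<in> {..<Suc k} - {a} - {b}. t i * q i)"
      using ab(2) \<open>a \<noteq> b\<close> by (intro sum.remove) auto
    also have "(\<Sum>i \<in> {..<Suc k} - {a} - {b}. t i * q i) = S"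
      unfolding S_def by (intro sum.cong) (auto simp: t_def)
    also have "t a * q a + (t b * q b + S) = 0"
      using \<open>q a \<noteq> 0\<close> \<open>a \<noteq> b\<close> by (simp add: t_def r_def field_simps)
    finally show ?thesis .
  qed
  have len: "length (drop_nth a T) = k" using T ab(1) by (simp add: length_drop_nth)
  obtain x where x: "\<And>l. l < k \<Longrightarrow> combine B k x (drop_nth a T ! l) =
      (let i = if l < a then l else Suc l in (-1) ^ i * t i)"
    using combine_surj_on_rows[of B "drop_nth a T" "\<lambda>l. let i = if l < a then l else Suc l in (-1) ^ i * t i"]
      \<open>q a \<noteq> 0\<close> unfolding len q_def by blast
  have comb: "combine B k x (T ! i) = (-1) ^ i * t i" if "i < Suc k" "i \<noteq> a" for i
  proof -
    define l where "l = (if i < a then i else i - 1)"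
    have l: "l < k" "(if l < a then l else Suc l) = i"
      using that ab(1) by (auto simp: l_def)
    then have "drop_nth a T ! l = T ! i"
      using T ab(1) by (simp add: nth_drop_nth)
    then show ?thesis using x[OF l(1)] unfolding Let_def l(2) by simp
  qed
  have sq: "(-1 :: real) ^ i * ((-1) ^ i * z) = z" for i z
    by (simp flip: mult.assoc power_mult_distrib)
  have comb_a: "(-1) ^ a * combine B k x (T ! a) = t a"
  proof -
    have "0 = (\<Sum>i<Suc k. (-1) ^ i * combine B k x (T ! i) * q i)"
      using minor_relation[OF T, of B x] by (simp add: q_def)
    also have "\<dots> = (-1) ^ a * combine B k x (T ! a) * q a +
        (\<Sum>i \<in> {..<Suc k} - {a}. (-1) ^ i * combine B k x (T ! i) * q i)"
      using ab(1) by (intro sum.remove) auto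
    also have "(\<Sum>i \<in> {..<Suc k} - {a}. (-1) ^ i * combine B k x (T ! i) * q i) =
        (\<Sum>i \<in> {..<Suc k} - {a}. t i * q i)"
      by (intro sum.cong) (auto simp: comb sq)
    also have "\<dots> = (\<Sum>i<Suc k. t i * q i) - t a * q a"
      using ab(1) by (subst sum.remove[of "{..<Suc k}" a]) auto
    finally show ?thesis using t_sum \<open>q a \<noteq> 0\<close> by simp
  qed
  have "1 * (-1) ^ i * combine B k x (T ! i) > 0" if "i < length T" for i
  proof (cases "i = a")
    case True
    then show ?thesis using comb_a t_pos[of a] by simp
  next
    case False
    then show ?thesis using comb[of i] that T t_pos[of i] by (simp add: sq)
  qed
  then have "alternates_on (combine B k x) T" unfolding alternates_on_def by blast
  then show False using noalt by blast
qed

lemma insort_mem_increasing_lists: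
  assumes "I \<in> increasing_lists n k" "a < n" "a \<notin> set I"
  shows "insort a I \<in> increasing_lists n (Suc k)"
  using assms by (auto simp: increasing_lists_iff strict_sorted_iff sorted_insort distinct_insort set_insort_key)

lemma drop_nth_insort:
  assumes "I \<in> increasing_lists n k" "a < n" "a \<notin> set I"
  shows "\<exists>d<Suc k. insort a I ! d = a \<and> drop_nth d (insort a I) = I"
proof -
  let ?T = "insort a I"
  have mem: "?T \<in> increasing_lists n (Suc k)" by (rule insort_mem_increasing_lists[OF assms])
  have "a \<in> set ?T" by (simp add: set_insort_key)
  moreover have "length ?T = Suc k" using mem by (simp add: increasing_lists_iff)
  ultimately obtain d where d: "d < Suc k" "?T ! d = a"
    by (auto simp: in_set_conv_nth)
  have "drop_nth d ?T \<in> increasing_lists n k" "set (drop_nth d ?T) = set I"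
    using drop_nth_mem_increasing_lists[OF mem d(1)] d(2) assms(3) by (auto simp: set_insort_key)
  then have "drop_nth d ?T = I" using assms(1)
    by (intro sorted_distinct_set_unique) (auto simp: increasing_lists_iff strict_sorted_iff)
  then show ?thesis using d by blast
qed

text \<open>
  Basis exchange for the rows of \<open>B\<close>, in a form that fits the relation between minors: choose \<open>x\<close>
  such that \<open>B x\<close> restricted to \<open>J\<close> is the indicator of \<open>a\<close>. If no admissible \<open>i\<close> existed, all
  terms of \<open>minor_relation\<close> would vanish except the one that belongs to \<open>a\<close> and to the minor of
  \<open>I\<close>.
\<close>

lemma minor_exchange:
  assumes I: "I \<in> increasing_lists n k" and J: "J \<in> increasing_lists n k"
    and nz: "minor B I \<noteq> 0" "minor B J \<noteq> 0"
    and a: "a \<in> set J" "a \<notin> set I" and T: "T = insort a I"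
  shows "\<exists>i<Suc k. T ! i \<notin> set J \<and> minor B (drop_nth i T) \<noteq> 0"
proof (rule ccontr)
  assume none: "\<not> ?thesis"
  have "a < n" using J a(1) by (auto simp: increasing_lists_iff)
  have mem: "T \<in> increasing_lists n (Suc k)" unfolding T
    by (rule insort_mem_increasing_lists[OF I \<open>a < n\<close> a(2)])
  have lenJ: "length J = k" and lenT: "length T = Suc k"
    using J mem by (auto simp: increasing_lists_iff)
  obtain p where p: "p < k" "J ! p = a" using a(1) lenJ by (auto simp: in_set_conv_nth)
  obtain x where x: "\<And>l. l < k \<Longrightarrow> combine B k x (J ! l) = (if l = p then 1 else 0)"
    using combine_surj_on_rows[OF nz(2), of "\<lambda>l. if l = p then 1 else 0"] unfolding lenJ by blast
  have x_J: "combine B k x c = (if c = a then 1 else 0)" if "c \<in> set J" for c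
    using that x p lenJ increasing_lists_distinct[OF J]
    by (auto simp: in_set_conv_nth nth_eq_iff_index_eq)
  obtain d where d: "d < Suc k" "T ! d = a" "drop_nth d T = I"
    using drop_nth_insort[OF I \<open>a < n\<close> a(2)] unfolding T by blast
  have "(\<Sum>i<Suc k. (-1) ^ i * combine B k x (T ! i) * minor B (drop_nth i T)) =
      (\<Sum>i<Suc k. if i = d then (-1) ^ i * minor B I else 0)"
  proof (rule sum.cong)
    fix i assume "i \<in> {..<Suc k}"
    then have i: "i < Suc k" by simp
    show "(-1) ^ i * combine B k x (T ! i) * minor B (drop_nth i T) =
        (if i = d then (-1) ^ i * minor B I else 0)"
    proof (cases "i = d")
      case True
      then show ?thesis using d x_J[OF a(1)] by simp
    next
      case False
      then have "T ! i \<noteq> a"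
        using increasing_lists_distinct[OF mem] i d lenT nth_eq_iff_index_eq[of T i d] by auto
      then show ?thesis using none i x_J[of "T ! i"] False by auto
    qed
  qed simp
  also have "\<dots> = (-1) ^ d * minor B I" using d(1) by simp
  finally show False using minor_relation[OF lenT, of B x] nz(1) by simp
qed

text \<open>
  The exchange property leads from \<open>I\<close> to \<open>J\<close> through nonzero minors, one entry being replaced at
  a time, and consecutive minors on this way have the same sign by
  \<open>adjacent_minors_same_sign\<close>.
\<close>

lemma minors_same_sign_of_no_alternation:
  assumes noalt: "\<And>x T. T \<in> increasing_lists n (Suc k) \<Longrightarrow> \<not> alternates_on (combine B k x) T"
    and "I \<in> increasing_lists n k" "J \<in> increasing_lists n k"
  shows "0 \<le> minor B I * minor B J"
  using assms(2)
proof (induction "card (set I - set J)" arbitrary: I)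
  case 0
  then have "set I \<subseteq> set J" by simp
  moreover have "card (set I) = k" "card (set J) = k"
    using 0 assms(3) by (auto simp: increasing_lists_distinct distinct_card increasing_lists_iff strict_sorted_iff)
  ultimately have "set I = set J" by (intro card_subset_eq) auto
  then have "I = J" using 0 assms(3)
    by (intro sorted_distinct_set_unique) (auto simp: increasing_lists_iff strict_sorted_iff)
  then show ?case by simp
next
  case (Suc d)
  show ?case
  proof (cases "minor B I = 0 \<or> minor B J = 0")
    case False
    have cards: "card (set I) = k" "card (set J) = k"
      using Suc.prems assms(3) by (auto simp: distinct_card increasing_lists_iff strict_sorted_iff)
    have "\<not> set J \<subseteq> set I"
    proof
      assume "set J \<subseteq> set I"
      then have "set J = set I" using cards by (intro card_subset_eq) auto
      then show False using Suc.hyps(2) by simp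
    qed
    then obtain a where a: "a \<in> set J" "a \<notin> set I" by blast
    define T where "T = insort a I"
    obtain i where i: "i < Suc k" "T ! i \<notin> set J" "minor B (drop_nth i T) \<noteq> 0"
      using minor_exchange[OF Suc.prems assms(3) _ _ a T_def] False by blast
    have "a < n" using assms(3) a(1) by (auto simp: increasing_lists_iff)
    have mem: "T \<in> increasing_lists n (Suc k)" unfolding T_def
      by (rule insort_mem_increasing_lists[OF Suc.prems \<open>a < n\<close> a(2)])
    have lenT: "length T = Suc k" using mem by (simp add: increasing_lists_iff)
    define I' where "I' = drop_nth i T"
    have I': "I' \<in> increasing_lists n k" "set I' = insert a (set I) - {T ! i}"
      using drop_nth_mem_increasing_lists[OF mem i(1)] by (auto simp: I'_def T_def set_insort_key)
    have "T ! i \<in> set I" using i(1,2) a(1) lenT nth_mem[of i T] by (auto simp: T_def set_insort_key)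
    then have "set I' - set J = (set I - set J) - {T ! i}" "T ! i \<in> set I - set J"
      using I'(2) i(2) a by auto
    then have "d = card (set I' - set J)" using Suc.hyps(2) by simp
    then have 1: "0 \<le> minor B I' * minor B J" using I'(1) by (rule Suc.hyps(1))
    obtain l where l: "l < Suc k" "drop_nth l T = I"
      using drop_nth_insort[OF Suc.prems \<open>a < n\<close> a(2)] unfolding T_def by blast
    have 2: "0 \<le> minor B I * minor B I'"
      using adjacent_minors_same_sign[OF noalt[OF mem] lenT l(1) i(1)] by (simp add: I'_def l(2))
    show ?thesis using 1 2 i(3) unfolding I'_def[symmetric]
      by (auto simp: zero_le_mult_iff)
  qed auto
qed

section \<open>The rank as the size of a largest nonzero minor\<close>

definition select_cols :: "(nat \<Rightarrow> nat \<Rightarrow> real) \<Rightarrow> nat list \<Rightarrow> nat \<Rightarrow> nat \<Rightarrow> real" where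
  "select_cols A J i j = A i (J ! j)"

lemma exists_function_on_entries:
  assumes "distinct J"
  shows "\<exists>y. \<forall>j<length J. y (J ! j) = x j"
proof (intro exI allI impI)
  fix j assume "j < length J"
  then show "x (the_inv_into {..<length J} ((!) J) (J ! j)) = x j"
    using assms by (subst the_inv_into_f_f) (auto intro: inj_on_nth)
qed

lemma combine_select_cols:
  assumes "distinct J" "length J = k"
  shows "combine (select_cols A J) k (\<lambda>j. y (J ! j)) i = (\<Sum>c\<in>set J. A i c * y c)"
  unfolding combine_def select_cols_def
  using sum.reindex_bij_betw[OF bij_betw_nth[OF assms(1) _ refl], of "{..<k}" "\<lambda>c. A i c * y c"] assms(2)
  by simp

text \<open>
  Indexing the coefficients by columns instead of by positions in \<open>J\<close> lets a column be added to \<open>J\<close>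
  without regard to the place where it goes.
\<close>

lemma minor_select_cols_eq_0_iff:
  assumes "distinct J" "length I = length J"
  shows "minor (select_cols A J) I = 0 \<longleftrightarrow>
    (\<exists>y. (\<exists>c\<in>set J. y c \<noteq> 0) \<and> (\<forall>i\<in>set I. (\<Sum>c\<in>set J. A i c * y c) = 0))" (is "_ \<longleftrightarrow> ?R")
proof
  assume "minor (select_cols A J) I = 0"
  then obtain x j where x: "j < length J" "x j \<noteq> 0"
      "\<forall>i\<in>set I. combine (select_cols A J) (length J) x i = 0"
    unfolding minor_eq_0_iff assms(2) by blast
  obtain y where y: "\<And>l. l < length J \<Longrightarrow> y (J ! l) = x l"
    using exists_function_on_entries[OF assms(1)] by metis
  have "combine (select_cols A J) (length J) (\<lambda>j. y (J ! j)) i =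
      combine (select_cols A J) (length J) x i" for i
    by (simp add: combine_def y)
  then show ?R using x y[OF x(1)] nth_mem[OF x(1)]
    unfolding combine_select_cols[OF assms(1) refl] by metis
next
  assume ?R
  then obtain y where y: "\<exists>c\<in>set J. y c \<noteq> 0" "\<forall>i\<in>set I. (\<Sum>c\<in>set J. A i c * y c) = 0" by blast
  then show "minor (select_cols A J) I = 0"
    unfolding minor_eq_0_iff assms(2)
    by (intro exI[of _ "\<lambda>j. y (J ! j)"])
       (auto simp: combine_select_cols[OF assms(1) refl] in_set_conv_nth)
qed

text \<open>
  The bordering argument: solve for the column \<open>t\<close> on the rows \<open>I\<close> in terms of the columns \<open>J\<close>. If
  the solution failed in a further row \<open>i\<close>, the minor bordered by the row \<open>i\<close> and the column \<open>t\<close>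
  would be nonzero.
\<close>

lemma column_in_span_of_maximal_minor:
  assumes I: "I \<in> increasing_lists n r" and J: "J \<in> increasing_lists m r"
    and nz: "minor (select_cols A J) I \<noteq> 0"
    and max: "\<And>I' J'. I' \<in> increasing_lists n (Suc r) \<Longrightarrow> J' \<in> increasing_lists m (Suc r) \<Longrightarrow>
      minor (select_cols A J') I' = 0"
    and t: "t < m"
  shows "\<exists>y. \<forall>i<n. A i t = (\<Sum>c\<in>set J. A i c * y c)"
proof (cases "t \<in> set J")
  case True
  then have "A i t = (\<Sum>c\<in>set J. A i c * (if c = t then 1 else 0))" for i
    by (simp add: if_distrib cong: if_cong)
  then show ?thesis by (intro exI[of _ "\<lambda>c. if c = t then 1 else 0"]) blast
next
  case False
  have lenI: "length I = r" and lenJ: "length J = r" and dJ: "distinct J"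
    using I J by (auto simp: increasing_lists_iff strict_sorted_iff)
  obtain x where x: "\<And>l. l < r \<Longrightarrow> combine (select_cols A J) r x (I ! l) = A (I ! l) t"
    using combine_surj_on_rows[OF nz, of "\<lambda>l. A (I ! l) t"] unfolding lenI by blast
  obtain y where yJ: "\<And>l. l < r \<Longrightarrow> y (J ! l) = x l"
    using exists_function_on_entries[OF dJ] unfolding lenJ by metis
  have "combine (select_cols A J) r (\<lambda>j. y (J ! j)) i = combine (select_cols A J) r x i" for i
    by (simp add: combine_def yJ)
  then have "(\<Sum>c\<in>set J. A (I ! l) c * y c) = A (I ! l) t" if "l < r" for l
    using x[OF that] combine_select_cols[OF dJ lenJ] by metis
  then have y: "(\<Sum>c\<in>set J. A i c * y c) = A i t" if "i \<in> set I" for i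
    using that lenI by (auto simp: in_set_conv_nth)
  have "A i t = (\<Sum>c\<in>set J. A i c * y c)" if "i < n" for i
  proof (cases "i \<in> set I")
    case notI: False
    have "minor (select_cols A (insort t J)) (insort i I) = 0"
      using insort_mem_increasing_lists[OF I \<open>i < n\<close> notI] insort_mem_increasing_lists[OF J t False]
      by (rule max)
    moreover have "distinct (insort t J)" using False dJ by (simp add: distinct_insort)
    ultimately obtain z where z: "\<exists>c\<in>insert t (set J). z c \<noteq> 0"
        "\<And>i'. i' \<in> insert i (set I) \<Longrightarrow> (\<Sum>c\<in>insert t (set J). A i' c * z c) = 0"
      using lenI lenJ by (subst (asm) minor_select_cols_eq_0_iff) (auto simp: set_insort_key)
    have z': "A i' t * z t + (\<Sum>c\<in>set J. A i' c * z c) = 0" if "i' \<in> insert i (set I)" for i'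
      using z(2)[OF that] False by simp
    have comb: "(\<Sum>c\<in>set J. A i' c * (z c + z t * y c)) =
        (\<Sum>c\<in>set J. A i' c * z c) + z t * (\<Sum>c\<in>set J. A i' c * y c)" for i'
      by (simp add: sum_distrib_left sum.distrib algebra_simps)
    have ker: "(\<Sum>c\<in>set J. A i' c * (z c + z t * y c)) = 0" if "i' \<in> set I" for i'
      using z'[of i'] y[OF that] that unfolding comb by (simp add: algebra_simps)
    have zJ: "z c + z t * y c = 0" if "c \<in> set J" for c
    proof -
      have "length I = length J" using lenI lenJ by simp
      from minor_select_cols_eq_0_iff[OF dJ this, of A]
      have "\<not> ((\<exists>c\<in>set J. z c + z t * y c \<noteq> 0) \<and>
          (\<forall>i'\<in>set I. (\<Sum>c\<in>set J. A i' c * (z c + z t * y c)) = 0))"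
        using nz by (auto simp only:)
      then show ?thesis using ker that by blast
    qed
    have "(\<Sum>c\<in>set J. A i c * (z c + z t * y c)) = 0" using zJ by simp
    moreover have "z t * ((\<Sum>c\<in>set J. A i c * y c) - A i t) =
        (\<Sum>c\<in>set J. A i c * (z c + z t * y c)) - (A i t * z t + (\<Sum>c\<in>set J. A i c * z c))"
      unfolding comb by (simp add: algebra_simps)
    ultimately have "z t * ((\<Sum>c\<in>set J. A i c * y c) - A i t) = 0"
      using z'[of i] by simp
    moreover have "z t \<noteq> 0"
      using z(1) zJ by auto
    ultimately show ?thesis by simp
  qed (simp add: y)
  then show ?thesis by blast
qed

lemma pick_set_sorted:
  assumes "sorted_wrt (<) I" "i < length I"
  shows "pick (set I) i = I ! i"
proof -
  have "{a \<in> set I. a < I ! i} = (!) I ` {..<i}"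
  proof (intro subset_antisym subsetI)
    fix a assume "a \<in> {a \<in> set I. a < I ! i}"
    then obtain l where l: "l < length I" "a = I ! l" "I ! l < I ! i" by (auto simp: in_set_conv_nth)
    have "l < i"
    proof (rule ccontr)
      assume "\<not> l < i"
      then have "I ! i \<le> I ! l"
        using assms l(1) by (cases "l = i") (auto simp: sorted_wrt_iff_nth_less intro: less_imp_le)
      then show False using l(3) by simp
    qed
    then show "a \<in> (!) I ` {..<i}" using l by auto
  next
    fix a assume "a \<in> (!) I ` {..<i}"
    then show "a \<in> {a \<in> set I. a < I ! i}"
      using assms by (auto simp: sorted_wrt_iff_nth_less)
  qed
  moreover have "inj_on ((!) I) {..<i}"
    using assms by (intro inj_on_nth) (auto simp: strict_sorted_iff)
  ultimately have "card {a \<in> set I. a < I ! i} = i" by (simp add: card_image)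
  then show ?thesis using pick_card_in_set[of "I ! i" "set I"] assms(2) by simp
qed

lemma det_submatrix_eq_minor:
  assumes X: "X \<in> carrier_mat n m"
    and I: "I \<in> increasing_lists n k" and J: "J \<in> increasing_lists m k"
  shows "det (submatrix X (set I) (set J)) = minor (select_cols (\<lambda>i j. X $$ (i, j)) J) I"
proof -
  have c: "card {i. i < n' \<and> i \<in> set L} = k" if "L \<in> increasing_lists n' k" for n' L
  proof -
    have "{i. i < n' \<and> i \<in> set L} = set L" using that by (auto simp: increasing_lists_iff)
    then show ?thesis using that by (simp add: distinct_card increasing_lists_iff strict_sorted_iff)
  qed
  have "submatrix X (set I) (set J) = mat k k (\<lambda>(i, j). X $$ (I ! i, J ! j))"
    using X c[OF I] c[OF J] I J
    by (intro eq_matI) (auto simp: submatrix_def pick_set_sorted increasing_lists_iff)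
  then show ?thesis using I by (simp add: minor_def select_cols_def increasing_lists_iff)
qed

lemma rank_le_of_columns_in_span:
  fixes X :: "real mat"
  assumes X: "X \<in> carrier_mat n m" and J: "set J \<subseteq> {0..<m}" "distinct J"
    and span: "\<And>t. t < m \<Longrightarrow> \<exists>y. \<forall>i<n. X $$ (i, t) = (\<Sum>c\<in>set J. X $$ (i, c) * y c)"
  shows "vec_space.rank n X \<le> length J"
proof -
  interpret vec_space "TYPE(real)" n .
  define C where "C = map (col X) J"
  have C: "set C \<subseteq> carrier_vec n" using X by (auto simp: C_def)
  have Cols: "set C \<subseteq> set (cols X)" using X J by (fastforce simp: C_def cols_def)
  have "set (cols X) \<subseteq> span (set C)"
  proof
    fix w assume "w \<in> set (cols X)"
    then obtain t where t: "t < m" "w = col X t" using X by (auto simp: cols_def)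
    obtain y where y: "\<And>i. i < n \<Longrightarrow> X $$ (i, t) = (\<Sum>c\<in>set J. X $$ (i, c) * y c)"
      using span[OF t(1)] by blast
    have "lincomb_list (\<lambda>l. y (J ! l)) C = mat_of_cols n C *\<^sub>v vec (length C) (\<lambda>l. y (J ! l))"
      by (rule lincomb_list_as_mat_mult) (use C in auto)
    also have "\<dots> = w"
    proof (rule eq_vecI)
      fix i assume "i < dim_vec w"
      then have i: "i < n" using t X by simp
      have "(mat_of_cols n C *\<^sub>v vec (length C) (\<lambda>l. y (J ! l))) $ i =
          (\<Sum>l<length J. X $$ (i, J ! l) * y (J ! l))"
        using i X J(1) nth_mem[of _ J]
        by (auto simp: C_def scalar_prod_def mat_of_cols_def lessThan_atLeast0 subset_iff intro!: sum.cong)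
      also have "\<dots> = (\<Sum>c\<in>set J. X $$ (i, c) * y c)"
        using sum.reindex_bij_betw[OF bij_betw_nth[OF J(2) refl refl]] by simp
      also have "\<dots> = w $ i" using y[OF i] t X i by simp
      finally show "(mat_of_cols n C *\<^sub>v vec (length C) (\<lambda>l. y (J ! l))) $ i = w $ i" .
    qed (use t X in simp)
    finally show "w \<in> span (set C)"
      using span_list_as_span[OF C] by (auto intro: in_span_listI)
  qed
  then have "span (set (cols X)) \<subseteq> span (set C)"
    using span_is_submodule[OF C] by (rule span_is_subset)
  then have eq: "span (set (cols X)) = span (set C)"
    using span_is_monotone[OF Cols] by blast
  have "lin_indpt {}" by (rule finite_lin_indpt2) auto
  then obtain U where U: "maximal U (\<lambda>T. T \<subseteq> set C \<and> lin_indpt T)"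
    using maximal_exists_superset[of "set C" "\<lambda>T. T \<subseteq> set C \<and> lin_indpt T" "{}"]
    by blast
  have "rank X = card U"
    unfolding rank_def eq using C U by (intro dim_span) auto
  also have "\<dots> \<le> card (set C)" using U by (intro card_mono) (auto simp: maximal_def)
  also have "\<dots> \<le> length J" using card_length[of C] by (simp add: C_def)
  finally show ?thesis .
qed

text \<open>
  A nonzero minor of maximal size \<open>r\<close> gives \<open>r \<le> k\<close>, because its columns are independent, and
  \<open>k \<le> r\<close>, because its columns span all columns by the bordering argument.
\<close>

lemma rank_minor_exists:
  fixes X :: "real mat"
  assumes X: "X \<in> carrier_mat n m" and k: "k = vec_space.rank n X"
  shows "\<exists>I \<in> increasing_lists n k. \<exists>J \<in> increasing_lists m k.
    minor (select_cols (\<lambda>i j. X $$ (i, j)) J) I \<noteq> 0 \<and>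
    (\<forall>t<m. \<exists>y. \<forall>i<n. X $$ (i, t) = (\<Sum>c\<in>set J. X $$ (i, c) * y c))"
proof -
  interpret vec_space "TYPE(real)" n .
  define P where "P r \<longleftrightarrow> (\<exists>I \<in> increasing_lists n r. \<exists>J \<in> increasing_lists m r.
      minor (select_cols (\<lambda>i j. X $$ (i, j)) J) I \<noteq> 0)" for r
  have le: "r \<le> k" if Pr: "P r" for r
  proof -
    obtain I J where IJ: "I \<in> increasing_lists n r" "J \<in> increasing_lists m r"
        "minor (select_cols (\<lambda>i j. X $$ (i, j)) J) I \<noteq> 0"
      using Pr unfolding P_def by blast
    have "card {j. j < m \<and> j \<in> set J} \<le> k" unfolding k
      by (rule rank_gt_minor[OF X, of "set I" "set J"])
        (use IJ(3) det_submatrix_eq_minor[OF X IJ(1,2)] in simp)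
    moreover have "{j. j < m \<and> j \<in> set J} = set J" using IJ(2) by (auto simp: increasing_lists_iff)
    ultimately show ?thesis using IJ(2) by (simp add: distinct_card increasing_lists_iff strict_sorted_iff)
  qed
  have "P 0" by (auto simp: P_def increasing_lists_iff minor_def)
  define r where "r = Greatest P"
  have "P r" unfolding r_def using \<open>P 0\<close> le by (rule GreatestI_nat)
  have "\<not> P (Suc r)" unfolding r_def using Greatest_le_nat[of P, OF _ le] by fastforce
  obtain I J where IJ: "I \<in> increasing_lists n r" "J \<in> increasing_lists m r"
      "minor (select_cols (\<lambda>i j. X $$ (i, j)) J) I \<noteq> 0"
    using \<open>P r\<close> unfolding P_def by blast
  have span: "\<exists>y. \<forall>i<n. X $$ (i, t) = (\<Sum>c\<in>set J. X $$ (i, c) * y c)" if "t < m" for t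
    using column_in_span_of_maximal_minor[OF IJ _ that] \<open>\<not> P (Suc r)\<close> unfolding P_def by blast
  have "k \<le> r" unfolding k
    using rank_le_of_columns_in_span[OF X _ _ span] IJ(2) by (auto simp: increasing_lists_iff strict_sorted_iff)
  then have "r = k" using le[OF \<open>P r\<close>] by simp
  then show ?thesis using IJ span by blast
qed

section \<open>Compound matrices and sign changes\<close>

lemma mult_mat_vec_index_sum:
  assumes "X \<in> carrier_mat n m" "u \<in> carrier_vec m" "i < n"
  shows "(X *\<^sub>v u) $ i = (\<Sum>t<m. X $$ (i, t) * u $ t)"
  using assms by (auto simp: scalar_prod_def lessThan_atLeast0 intro!: sum.cong)

lemma same_sign_iff_pairwise:
  "same_sign v \<longleftrightarrow> (\<forall>i<dim_vec v. \<forall>j<dim_vec v. 0 \<le> v $ i * v $ j)"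
proof
  assume "same_sign v"
  then show "\<forall>i<dim_vec v. \<forall>j<dim_vec v. 0 \<le> v $ i * v $ j"
    by (auto simp: same_sign_def zero_le_mult_iff)
next
  assume *: "\<forall>i<dim_vec v. \<forall>j<dim_vec v. 0 \<le> v $ i * v $ j"
  show "same_sign v"
  proof (rule ccontr)
    assume "\<not> same_sign v"
    then obtain i j where "i < dim_vec v" "j < dim_vec v" "v $ i < 0" "0 < v $ j"
      by (auto simp: same_sign_def not_le)
    moreover from this have "v $ i * v $ j < 0" by (simp add: mult_neg_pos)
    ultimately show False using * by fastforce
  qed
qed

theorem theorem3:
  fixes X :: "real mat" and n m k :: nat
  assumes "X \<in> carrier_mat n m"
    and "n > m"
    and "k = vec_space.rank n X"
    and "k < m"
  shows "(\<forall>j < dim_col (compound_mat k X). same_sign (col (compound_mat k X) j))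
         \<longleftrightarrow> (\<forall>u \<in> carrier_vec m. S_minus (X *\<^sub>v u) \<le> int k - 1)"
proof -
  define A where "A = (\<lambda>i j. X $$ (i, j))"
  note X = assms(1)
  have "(\<forall>j < dim_col (compound_mat k X). same_sign (col (compound_mat k X) j)) \<longleftrightarrow>
      (\<forall>J \<in> increasing_lists m k. \<forall>I \<in> increasing_lists n k. \<forall>I' \<in> increasing_lists n k.
        0 \<le> minor (select_cols A J) I * minor (select_cols A J) I')"
  proof -
    have dims: "dim_row (compound_mat k X) = length (k_subsets n k)"
        "dim_col (compound_mat k X) = length (k_subsets m k)"
      using X by (simp_all add: compound_mat_def length_k_subsets)
    have entry: "compound_mat k X $$ (i, j) = minor (select_cols A (k_subsets m k ! j)) (k_subsets n k ! i)"
      if "i < length (k_subsets n k)" "j < length (k_subsets m k)" for i j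
      unfolding A_def using X that
      by (subst det_submatrix_eq_minor[OF X, of _ k, symmetric]) (auto simp: compound_mat_def length_k_subsets)
    show ?thesis
      unfolding same_sign_iff_pairwise using dims entry
      by (simp add: all_set_conv_all_nth)
  qed
  also have "\<dots> \<longleftrightarrow> (\<forall>u \<in> carrier_vec m. \<forall>T \<in> increasing_lists n (Suc k). \<not> alternates_on (($) (X *\<^sub>v u)) T)"
    (is "?L \<longleftrightarrow> ?R")
  proof
    \<comment> \<open>The columns \<open>J\<close> of a nonzero minor of size \<open>k\<close> span the column space, so that every
      \<open>X u\<close> is a combination of them.\<close>
    assume L: ?L
    obtain I J where IJ: "I \<in> increasing_lists n k" "J \<in> increasing_lists m k"
        "minor (select_cols A J) I \<noteq> 0"
        "\<And>t. t < m \<Longrightarrow> \<exists>y. \<forall>i<n. A i t = (\<Sum>c\<in>set J. A i c * y c)"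
      using rank_minor_exists[OF X assms(3)] unfolding A_def by blast
    have J: "distinct J" "length J = k" using IJ(2) by (auto simp: increasing_lists_iff strict_sorted_iff)
    obtain Y where Y: "\<And>t i. t < m \<Longrightarrow> i < n \<Longrightarrow> A i t = (\<Sum>c\<in>set J. A i c * Y t c)"
      using IJ(4) by metis
    show ?R
    proof (intro ballI notI)
      fix u T assume u: "u \<in> carrier_vec m" and T: "T \<in> increasing_lists n (Suc k)"
        and alt: "alternates_on (($) (X *\<^sub>v u)) T"
      define y where "y c = (\<Sum>t<m. Y t c * u $ t)" for c
      have "(X *\<^sub>v u) $ i = combine (select_cols A J) k (\<lambda>j. y (J ! j)) i" if "i < n" for i
      proof -
        have "(X *\<^sub>v u) $ i = (\<Sum>t<m. A i t * u $ t)"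
          using mult_mat_vec_index_sum[OF X u that] by (simp add: A_def)
        also have "\<dots> = (\<Sum>t<m. \<Sum>c\<in>set J. A i c * Y t c * u $ t)"
          using Y that by (intro sum.cong) (auto simp: sum_distrib_right)
        also have "\<dots> = (\<Sum>c\<in>set J. A i c * y c)"
          by (subst sum.swap) (simp add: y_def sum_distrib_left mult.assoc)
        finally show ?thesis by (simp add: combine_select_cols[OF J])
      qed
      moreover have "T ! i < n" if "i < length T" for i
        using increasing_lists_nth_less[OF T that] .
      ultimately have "alternates_on (combine (select_cols A J) k (\<lambda>j. y (J ! j))) T"
        using alt unfolding alternates_on_def by auto
      moreover have "\<not> alternates_on (combine (select_cols A J) k (\<lambda>j. y (J ! j))) T"
        using L IJ by (intro no_alternation_of_same_sign_minors[OF T, of "minor (select_cols A J) I"]) auto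
      ultimately show False by blast
    qed
  next
    \<comment> \<open>For each \<open>J\<close> separately, the combinations of the columns \<open>J\<close> are among the vectors \<open>X u\<close>;
      the signs agree trivially if these columns are dependent, as then all minors vanish.\<close>
    assume R: ?R
    show ?L
    proof (intro ballI)
      fix J I I'
      assume J: "J \<in> increasing_lists m k" and I: "I \<in> increasing_lists n k" "I' \<in> increasing_lists n k"
      have J': "distinct J" "length J = k" "set J \<subseteq> {0..<m}"
        using J by (auto simp: increasing_lists_iff strict_sorted_iff)
      show "0 \<le> minor (select_cols A J) I * minor (select_cols A J) I'"
      proof (rule minors_same_sign_of_no_alternation[OF _ I])
        fix x T assume T: "T \<in> increasing_lists n (Suc k)"
        define u :: "real vec" where "u = vec m (\<lambda>t. \<Sum>l<k. if J ! l = t then x l else 0)"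
        have "(X *\<^sub>v u) $ i = combine (select_cols A J) k x i" if "i < n" for i
        proof -
          have "(X *\<^sub>v u) $ i = (\<Sum>t<m. \<Sum>l<k. if J ! l = t then A i t * x l else 0)"
            using mult_mat_vec_index_sum[OF X _ that, of u]
            by (simp add: A_def u_def sum_distrib_left if_distrib cong: if_cong)
          also have "\<dots> = (\<Sum>l<k. A i (J ! l) * x l)"
            using increasing_lists_nth_less[OF J] J' by (subst sum.swap) (auto intro!: sum.cong)
          finally show ?thesis by (simp add: combine_def select_cols_def)
        qed
        moreover have "T ! i < n" if "i < length T" for i
          using increasing_lists_nth_less[OF T that] .
        moreover have "\<not> alternates_on (($) (X *\<^sub>v u)) T"
          using R T by (simp add: u_def)
        ultimately show "\<not> alternates_on (combine (select_cols A J) k x) T"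
          unfolding alternates_on_def by auto
      qed
    qed
  qed
  also have "\<dots> \<longleftrightarrow> (\<forall>u \<in> carrier_vec m. S_minus (X *\<^sub>v u) \<le> int k - 1)"
  proof (rule ball_cong[OF refl])
    fix u :: "real vec"
    show "(\<forall>T \<in> increasing_lists n (Suc k). \<not> alternates_on (($) (X *\<^sub>v u)) T) \<longleftrightarrow>
        S_minus (X *\<^sub>v u) \<le> int k - 1"
      using k_le_S_minus_iff[of k "X *\<^sub>v u"] X by auto
  qed
  finally show ?thesis .
qed

end
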